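(* For every integer $n \geq 3$, the number of permutations $\pi$ of $\{1,2,\dots,n\}$ which contain exactly one occurrence of the pattern $132$ and no occurrence of the pattern $123$ equals $(n-2)2^{n-3}$.
   Context: A permutation $\pi$ of $\{1,\dots,n\}$ is written as the sequence $\pi(1)\pi(2)\cdots\pi(n)$. An occurrence of the pattern $123$ in $\pi$ is a triple of indices $i<j<k$ with $\pi(i)<\pi(j)<\pi(k)$. An occurrence of the pattern $132$ in $\pi$ is a triple of indices $i<j<k$ with $\pi(i)<\pi(k)<\pi(j)$. A permutation avoids a pattern if it has no occurrence of it. *)

theory Defs
  imports "HOL-Combinatorics.Permutations"
begin

definition occurrences_123 :: "nat \<Rightarrow> (nat \<Rightarrow> nat) \<Rightarrow> (nat \<times> nat \<times> nat) set" where
  "occurrences_123 n \<pi> =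
     {(i, j, k). 1 \<le> i \<and> i < j \<and> j < k \<and> k \<le> n \<and> \<pi> i < \<pi> j \<and> \<pi> j < \<pi> k}"

definition occurrences_132 :: "nat \<Rightarrow> (nat \<Rightarrow> nat) \<Rightarrow> (nat \<times> nat \<times> nat) set" where
  "occurrences_132 n \<pi> =
     {(i, j, k). 1 \<le> i \<and> i < j \<and> j < k \<and> k \<le> n \<and> \<pi> i < \<pi> k \<and> \<pi> k < \<pi> j}"

end

theory Submission
  imports Defs "HOL-Library.FuncSet"
begin

text \<open>
  Let \<open>g i\<close> be the number of entries to the right of position \<open>i\<close> that are larger than \<open>\<pi> i\<close>.
  The sequence \<open>g\<close> is a Lehmer code, so it runs bijectively over all sequences with
  \<open>g i \<le> n - i\<close>. Any two larger entries to the right of \<open>i\<close> form with \<open>i\<close> an occurrence of exactly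
  one of 123 and 132. So there is exactly one occurrence in total iff \<open>g i = 2\<close> for one \<open>i\<close> and
  \<open>g m \<le> 1\<close> for all other \<open>m\<close>. The first of the two larger entries must then sit at \<open>i + 1\<close>, since
  an entry between it and \<open>i\<close> would see both of them; the occurrence is a 132 iff
  \<open>g (i + 1) = 0\<close>. There are \<open>n - 2\<close> choices for \<open>i\<close>, and the \<open>n - 3\<close> positions other
  than \<open>i\<close>, \<open>i + 1\<close>, \<open>n\<close> carry an arbitrary bit.
\<close>

section \<open>Lehmer codes of permutations\<close>

definition later_larger :: "nat \<Rightarrow> (nat \<Rightarrow> nat) \<Rightarrow> nat \<Rightarrow> nat set" where
  "later_larger n \<pi> i = {j. i < j \<and> j \<le> n \<and> \<pi> i < \<pi> j}"

text \<open>The restriction to \<open>{1..n}\<close> makes codes extensional, so that they lie in a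
  product \<open>PiE\<close> whose cardinality is a product.\<close>

definition lehmer_code :: "nat \<Rightarrow> (nat \<Rightarrow> nat) \<Rightarrow> nat \<Rightarrow> nat" where
  "lehmer_code n \<pi> = (\<lambda>i\<in>{1..n}. card (later_larger n \<pi> i))"

lemma later_larger_subset: "later_larger n \<pi> i \<subseteq> {i<..n}"
  by (auto simp: later_larger_def)

lemma finite_later_larger [simp]: "finite (later_larger n \<pi> i)"
  by (rule finite_subset[OF later_larger_subset]) simp

lemma card_later_larger_le: "card (later_larger n \<pi> i) \<le> n - i"
  using card_mono[OF _ later_larger_subset[of n \<pi> i]] by simp

text \<open>Passing from positions to values makes the count depend only on \<open>\<pi> i\<close>
  and the set of values used before \<open>i\<close>, as left-to-right decoding requires.\<close>

lemma image_later_larger: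
  assumes "\<pi> permutes {1..n}" "i \<in> {1..n}"
  shows "\<pi> ` later_larger n \<pi> i = {v \<in> {1..n} - \<pi> ` {1..<i}. \<pi> i < v}"
proof (intro equalityI subsetI)
  fix v assume "v \<in> \<pi> ` later_larger n \<pi> i"
  then obtain j where j: "i < j" "j \<le> n" "\<pi> i < \<pi> j" "v = \<pi> j"
    by (auto simp: later_larger_def)
  have "\<pi> j \<in> {1..n}"
    using permutes_in_image[OF assms(1), of j] assms j by auto
  moreover have "\<pi> j \<notin> \<pi> ` {1..<i}"
    using j by (auto simp: inj_eq[OF permutes_inj[OF assms(1)]])
  ultimately show "v \<in> {v \<in> {1..n} - \<pi> ` {1..<i}. \<pi> i < v}"
    using j by auto
next
  fix v assume v: "v \<in> {v \<in> {1..n} - \<pi> ` {1..<i}. \<pi> i < v}"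
  then obtain j where j: "j \<in> {1..n}" "v = \<pi> j"
    using permutes_image[OF assms(1)] by blast
  moreover have "\<not> j < i" "j \<noteq> i"
    using v j by auto
  ultimately show "v \<in> \<pi> ` later_larger n \<pi> i"
    using v by (auto simp: later_larger_def)
qed

lemma card_later_larger:
  assumes "\<pi> permutes {1..n}" "i \<in> {1..n}"
  shows "card (later_larger n \<pi> i) = card {v \<in> {1..n} - \<pi> ` {1..<i}. \<pi> i < v}"
  using card_image[OF inj_on_subset[OF permutes_inj[OF assms(1)] subset_UNIV], of "later_larger n \<pi> i"]
  by (simp add: image_later_larger[OF assms])

lemma card_greater_inj:
  fixes a b :: "'a :: linorder"
  assumes "finite R" "a \<in> R" "b \<in> R"
    and "card {v \<in> R. a < v} = card {v \<in> R. b < v}"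
  shows "a = b"
proof -
  have less: "card {v \<in> R. y < v} < card {v \<in> R. x < v}" if "x < y" "y \<in> R" for x y
    using assms(1) that by (intro psubset_card_mono) auto
  show ?thesis
    using less[of a b] less[of b a] assms by (cases a b rule: linorder_cases) auto
qed

lemma inj_on_lehmer_code: "inj_on (lehmer_code n) {\<pi>. \<pi> permutes {1..n}}"
proof (rule inj_onI)
  fix \<pi> \<sigma>
  assume "\<pi> \<in> {\<pi>. \<pi> permutes {1..n}}" "\<sigma> \<in> {\<pi>. \<pi> permutes {1..n}}"
    and eq: "lehmer_code n \<pi> = lehmer_code n \<sigma>"
  then have \<pi>: "\<pi> permutes {1..n}" and \<sigma>: "\<sigma> permutes {1..n}" by auto
  have agree: "\<pi> i = \<sigma> i" if "i \<in> {1..n}" for i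
    using that
  proof (induction i rule: less_induct)
    case (less i)
    have img: "\<pi> ` {1..<i} = \<sigma> ` {1..<i}"
      using less by (intro image_cong) auto
    have "\<pi> i \<notin> \<pi> ` {1..<i}" "\<sigma> i \<notin> \<sigma> ` {1..<i}"
      by (auto simp: inj_eq[OF permutes_inj[OF \<pi>]] inj_eq[OF permutes_inj[OF \<sigma>]])
    then have "\<pi> i \<in> {1..n} - \<pi> ` {1..<i}" "\<sigma> i \<in> {1..n} - \<pi> ` {1..<i}"
      using permutes_in_image[OF \<pi>, of i] permutes_in_image[OF \<sigma>, of i] less.prems img by auto
    moreover have "card (later_larger n \<pi> i) = card (later_larger n \<sigma> i)"
      using fun_cong[OF eq, of i] less.prems by (simp add: lehmer_code_def)
    ultimately show ?case
      using card_greater_inj[of "{1..n} - \<pi> ` {1..<i}" "\<pi> i" "\<sigma> i"]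
        card_later_larger[OF \<pi> less.prems] card_later_larger[OF \<sigma> less.prems] img
      by simp
  qed
  show "\<pi> = \<sigma>"
  proof
    fix i show "\<pi> i = \<sigma> i"
      using agree[of i] permutes_not_in[OF \<pi>, of i] permutes_not_in[OF \<sigma>, of i]
      by (cases "i \<in> {1..n}") auto
  qed
qed

text \<open>Surjectivity follows by counting: the code is injective, and both sides have
  \<open>n!\<close> elements.\<close>

lemma bij_betw_lehmer_code:
  "bij_betw (lehmer_code n) {\<pi>. \<pi> permutes {1..n}} (\<Pi>\<^sub>E i\<in>{1..n}. {..n - i})"
proof -
  let ?P = "{\<pi>. \<pi> permutes {1..n}}" and ?C = "\<Pi>\<^sub>E i\<in>{1..n}. {..n - i}"
  have "lehmer_code n ` ?P \<subseteq> ?C"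
    by (auto simp: lehmer_code_def card_later_larger_le)
  moreover have "finite ?C"
    by (intro finite_PiE) auto
  moreover have "card (lehmer_code n ` ?P) = card ?C"
  proof -
    have "card (lehmer_code n ` ?P) = fact n"
      by (simp add: card_image[OF inj_on_lehmer_code] card_permutations del: One_nat_def)
    also have "\<dots> = (\<Prod>i=1..n. Suc (n - i))"
      unfolding fact_prod of_nat_id
      by (rule prod.reindex_bij_witness[where i = "\<lambda>i. Suc (n - i)" and j = "\<lambda>i. Suc (n - i)"]) auto
    also have "\<dots> = card ?C"
      by (simp add: card_PiE)
    finally show ?thesis .
  qed
  ultimately show ?thesis
    using inj_on_lehmer_code card_subset_eq unfolding bij_betw_def by blast
qed

section \<open>Characterisation of a single 132 by the counts\<close>

lemma occurrence_123_or_132: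
  assumes "\<pi> permutes {1..n}" "1 \<le> m" "p \<in> later_larger n \<pi> m" "q \<in> later_larger n \<pi> m" "p < q"
  shows "(m, p, q) \<in> occurrences_123 n \<pi> \<or> (m, p, q) \<in> occurrences_132 n \<pi>"
proof -
  have "\<pi> p \<noteq> \<pi> q"
    using assms(5) by (auto simp: inj_eq[OF permutes_inj[OF assms(1)]])
  then show ?thesis
    using assms by (auto simp: later_larger_def occurrences_123_def occurrences_132_def)
qed

lemma occurrence_later_larger:
  assumes "(m, p, q) \<in> occurrences_123 n \<pi> \<union> occurrences_132 n \<pi>"
  shows "1 \<le> m" "m \<le> n" "p < q" "p \<in> later_larger n \<pi> m" "q \<in> later_larger n \<pi> m"
  using assms by (auto simp: later_larger_def occurrences_123_def occurrences_132_def)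

text \<open>The hypothesis means that \<open>Suc i\<close> is itself not larger than \<open>i\<close>, so it is below everything that is.\<close>

lemma later_larger_Suc:
  assumes "i < n" "Suc i \<notin> later_larger n \<pi> i"
  shows "later_larger n \<pi> i \<subseteq> later_larger n \<pi> (Suc i)"
proof
  fix j assume j: "j \<in> later_larger n \<pi> i"
  then have "j \<noteq> Suc i" using assms(2) by auto
  moreover have "\<pi> (Suc i) \<le> \<pi> i"
    using assms by (auto simp: later_larger_def)
  ultimately show "j \<in> later_larger n \<pi> (Suc i)"
    using j by (auto simp: later_larger_def)
qed

lemma single_132_iff:
  assumes \<pi>: "\<pi> permutes {1..n}"
  shows "card (occurrences_132 n \<pi>) = 1 \<and> occurrences_123 n \<pi> = {} \<longleftrightarrow>
    (\<exists>i\<in>{1..n-2}. card (later_larger n \<pi> i) = 2 \<and> card (later_larger n \<pi> (Suc i)) = 0 \<and>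
       (\<forall>m\<in>{1..n} - {i, Suc i}. card (later_larger n \<pi> m) \<le> 1))"
    (is "?lhs \<longleftrightarrow> ?rhs")
proof
  let ?G = "later_larger n \<pi>"
  assume ?lhs
  then obtain i j k where one: "occurrences_132 n \<pi> = {(i, j, k)}" and none: "occurrences_123 n \<pi> = {}"
    by (metis card_1_singletonE prod_cases3)
  then have "(i, j, k) \<in> occurrences_132 n \<pi>" by simp
  then have ijk: "1 \<le> i" "i < j" "j < k" "k \<le> n" "j \<in> ?G i" "k \<in> ?G i"
    by (auto simp: occurrences_132_def later_larger_def)
  have uniq: "m = i \<and> p = j \<and> q = k" if "1 \<le> m" "p \<in> ?G m" "q \<in> ?G m" "p < q" for m p q
    using occurrence_123_or_132[OF \<pi> that] one none by auto
  \<comment> \<open>Pair \<open>r\<close> with \<open>k\<close>: \<open>r < k\<close> forces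
    \<open>r = j\<close> by uniqueness, while \<open>k < r\<close> would force
    \<open>k = j\<close>.\<close>
  have "r = j \<or> r = k" if "r \<in> ?G i" for r
    using uniq[OF ijk(1) that ijk(6)] uniq[OF ijk(1,6) that] by (cases r k rule: linorder_cases) auto
  with ijk have "?G i = {j, k}" by auto
  then have two: "card (?G i) = 2"
    using ijk by simp
  have le1: "card (?G m) \<le> 1" if "1 \<le> m" "m \<noteq> i" for m
  proof -
    have "p = q" if "p \<in> ?G m" "q \<in> ?G m" for p q
      using uniq[of m p q] uniq[of m q p] that \<open>1 \<le> m\<close> \<open>m \<noteq> i\<close> by (metis nat_neq_iff)
    then show ?thesis
      by (simp add: card_le_Suc0_iff_eq)
  qed
  \<comment> \<open>Otherwise \<open>Suc i\<close> would see both larger entries of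
    \<open>i\<close>, against \<open>le1\<close>.\<close>
  have "Suc i \<in> ?G i"
  proof (rule ccontr)
    assume "Suc i \<notin> ?G i"
    then have "?G i \<subseteq> ?G (Suc i)"
      using later_larger_Suc[of i n \<pi>] ijk by auto
    then have "card (?G i) \<le> card (?G (Suc i))"
      by (simp add: card_mono)
    with two le1[of "Suc i"] show False by simp
  qed
  with \<open>?G i = {j, k}\<close> ijk have j: "j = Suc i" by auto
  \<comment> \<open>A later entry \<open>r\<close> above \<open>\<pi> j\<close> would make
    \<open>(i, j, r)\<close> a 123.\<close>
  have "?G j = {}"
    using none ijk by (auto simp: occurrences_123_def later_larger_def set_eq_iff)
  with two le1 ijk j show ?rhs
    by (intro bexI[of _ i]) auto
next
  let ?G = "later_larger n \<pi>"
  assume ?rhs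
  then obtain i where i: "1 \<le> i" "i \<le> n - 2" and two: "card (?G i) = 2"
    and zero: "?G (Suc i) = {}"
    and le1: "\<And>m. 1 \<le> m \<Longrightarrow> m \<le> n \<Longrightarrow> m \<noteq> i \<Longrightarrow> card (?G m) \<le> 1"
    by (force simp: card_eq_0_iff)
  have "Suc i \<in> ?G i"
    using later_larger_Suc[of i n \<pi>] i two zero by force
  then have "card (?G i - {Suc i}) = 1"
    using two by simp
  then obtain k where "?G i - {Suc i} = {k}"
    by (rule card_1_singletonE)
  with \<open>Suc i \<in> ?G i\<close> have k: "?G i = {Suc i, k}" "k \<noteq> Suc i"
    by blast+
  have "k \<in> ?G i" using k by simp
  then have ik: "Suc i < k" "k \<le> n" "\<pi> i < \<pi> k"
    using k by (auto simp: later_larger_def)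
  \<comment> \<open>An occurrence starts at a position with two larger later entries, which only
    \<open>i\<close> has.\<close>
  have occ: "(m, p, q) = (i, Suc i, k)" if "(m, p, q) \<in> occurrences_123 n \<pi> \<union> occurrences_132 n \<pi>" for m p q
  proof -
    note mpq = occurrence_later_larger[OF that]
    have "card {p, q} \<le> card (?G m)"
      using mpq by (intro card_mono) auto
    with mpq le1[of m] have "m = i" by fastforce
    then have "p \<in> {Suc i, k}" "q \<in> {Suc i, k}"
      using mpq(4,5) k(1) by blast+
    with \<open>m = i\<close> mpq(3) ik(1) show ?thesis by auto
  qed
  have "(i, Suc i, k) \<notin> occurrences_123 n \<pi>"
    using zero ik by (auto simp: occurrences_123_def later_larger_def)
  moreover from this have "(i, Suc i, k) \<in> occurrences_132 n \<pi>"
    using occurrence_123_or_132[OF \<pi> i(1), of "Suc i" k] k ik by auto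
  ultimately have "occurrences_132 n \<pi> = {(i, Suc i, k)}" "occurrences_123 n \<pi> = {}"
    using occ by auto
  then show ?lhs by simp
qed

section \<open>Counting the admissible codes\<close>

definition single_132_codes :: "nat \<Rightarrow> nat \<Rightarrow> (nat \<Rightarrow> nat) set" where
  "single_132_codes n i =
     (\<Pi>\<^sub>E m\<in>{1..n}. if m = i then {2} else if m = Suc i \<or> m = n then {0} else {..1})"

lemma finite_single_132_codes: "finite (single_132_codes n i)"
  unfolding single_132_codes_def by (intro finite_PiE) auto

lemma card_single_132_codes:
  assumes "1 \<le> i" "i \<le> n - 2"
  shows "card (single_132_codes n i) = 2 ^ (n - 3)"
proof -
  have "card (single_132_codes n i) =
      (\<Prod>m\<in>{1..n}. if m \<in> {i, Suc i, n} then 1 else 2)"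
    unfolding single_132_codes_def by (simp add: card_PiE) (rule prod.cong, auto)
  also have "\<dots> = (\<Prod>m\<in>{1..n} - {i, Suc i, n}. 2)"
    by (rule prod.mono_neutral_cong_right) auto
  also have "\<dots> = 2 ^ (n - 3)"
    using assms by (simp add: card_Diff_subset)
  finally show ?thesis .
qed

text \<open>The value 2 occurs in a code only at its index \<open>i\<close>, so the code determines
  \<open>i\<close>.\<close>

lemma single_132_codes_disjoint:
  assumes "1 \<le> i" "i \<le> n" "i \<noteq> j"
  shows "single_132_codes n i \<inter> single_132_codes n j = {}"
proof -
  have False if "c \<in> single_132_codes n i" "c \<in> single_132_codes n j" for c
  proof -
    have "c i = 2" "c i \<noteq> 2"
      using PiE_mem[OF that(1)[unfolded single_132_codes_def], of i]
        PiE_mem[OF that(2)[unfolded single_132_codes_def], of i] assms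
      by (auto split: if_splits)
    then show False by simp
  qed
  then show ?thesis by auto
qed

lemma single_132_codes_subset:
  assumes "1 \<le> i" "i \<le> n - 2"
  shows "single_132_codes n i \<subseteq> (\<Pi>\<^sub>E m\<in>{1..n}. {..n - m})"
  unfolding single_132_codes_def using assms by (intro PiE_mono) auto

lemma lehmer_code_in_single_132_codes_iff:
  assumes "1 \<le> i" "i \<le> n - 2"
  shows "lehmer_code n \<pi> \<in> single_132_codes n i \<longleftrightarrow>
    card (later_larger n \<pi> i) = 2 \<and> card (later_larger n \<pi> (Suc i)) = 0 \<and>
    (\<forall>m\<in>{1..n} - {i, Suc i}. card (later_larger n \<pi> m) \<le> 1)"
proof -
  \<comment> \<open>The right-hand side only bounds the entry at \<open>n\<close> by 1, whereas the
    codes demand 0 there.\<close>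
  have "card (later_larger n \<pi> n) = 0"
    using card_later_larger_le[of n \<pi> n] by simp
  then show ?thesis
    using assms unfolding single_132_codes_def lehmer_code_def
    by (auto simp: PiE_iff split: if_splits)
qed

theorem theorem2:
  fixes n :: nat
  assumes "n \<ge> 3"
  shows "card {\<pi>. \<pi> permutes {1..n} \<and> card (occurrences_132 n \<pi>) = 1 \<and> occurrences_123 n \<pi> = {}}
           = (n - 2) * 2 ^ (n - 3)"
proof -
  let ?S = "{\<pi>. \<pi> permutes {1..n} \<and> card (occurrences_132 n \<pi>) = 1 \<and> occurrences_123 n \<pi> = {}}"
  let ?C = "\<Union>i\<in>{1..n-2}. single_132_codes n i"
  have "lehmer_code n \<pi> \<in> ?C \<longleftrightarrow> card (occurrences_132 n \<pi>) = 1 \<and> occurrences_123 n \<pi> = {}"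
    if "\<pi> permutes {1..n}" for \<pi>
    unfolding single_132_iff[OF that] UN_iff
    by (rule bex_cong[OF refl], rule lehmer_code_in_single_132_codes_iff) simp_all
  then have S: "?S = {\<pi> \<in> {\<pi>. \<pi> permutes {1..n}}. lehmer_code n \<pi> \<in> ?C}"
    by blast
  \<comment> \<open>Every code in \<open>?C\<close> is thus attained by some permutation, so the
    image of \<open>?S\<close> is all of \<open>?C\<close>.\<close>
  have "?C \<subseteq> (\<Pi>\<^sub>E m\<in>{1..n}. {..n - m})"
    by (rule UN_least, rule single_132_codes_subset) simp_all
  then have "lehmer_code n ` ?S = ?C"
    unfolding S bij_betw_imp_surj_on[OF bij_betw_lehmer_code, symmetric] by blast
  moreover have "inj_on (lehmer_code n) ?S"
    by (rule inj_on_subset[OF inj_on_lehmer_code]) auto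
  ultimately have "card ?S = card ?C"
    using card_image by fastforce
  also have "\<dots> = (\<Sum>i\<in>{1..n-2}. card (single_132_codes n i))"
    by (intro card_UN_disjoint ballI impI finite_single_132_codes single_132_codes_disjoint) auto
  also have "\<dots> = (n - 2) * 2 ^ (n - 3)"
    by (simp add: card_single_132_codes)
  finally show ?thesis .
qed

end
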